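(* There exists a universal constant $c>0$ such that for every $n\ge 1$, every $a\in\mathbb{R}^n$ and $t\in\mathbb{R}$, the halfspace $f:\{-1,1\}^n\to\{0,1\}$, $f(x)=\mathbf{1}\left(\sum_{i=1}^n a_i x_i>t\right)$, satisfies the following: if $\mathbb{E}[f]\le \frac12$, then $$c\,\mathbb{E}[f]^2\log\frac{1}{\mathbb{E}[f]}\;\le\; W^1(f)\;\le\; 2\,\mathbb{E}[f]^2\log\frac{1}{\mathbb{E}[f]}.$$
   Context: Expectations are with respect to the uniform measure on $\{-1,1\}^n$. For $f:\{-1,1\}^n\to\mathbb{R}$ and $S\subseteq\{1,\dots,n\}$, the Fourier coefficient is $\hat f(S)=\mathbb{E}\left[f(x)\prod_{i\in S}x_i\right]$, and $W^1(f)=\sum_{i=1}^n \hat f(\{i\})^2$. $\log$ is the natural logarithm. If $\mathbb{E}[f]=0$, the expression $\mathbb{E}[f]^2\log(1/\mathbb{E}[f])$ is interpreted as $0$. *)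

theory Defs
  imports "HOL-Probability.Probability"
begin

(* A point of {-1,1}^n is a function on the index set {1..n}, extended by
   the value undefined outside it, so that the cube has exactly 2^n elements. *)
definition cube :: "nat \<Rightarrow> (nat \<Rightarrow> real) set" where
  "cube n = {1..n} \<rightarrow>\<^sub>E {-1, 1}"

definition cube_expectation :: "nat \<Rightarrow> ((nat \<Rightarrow> real) \<Rightarrow> real) \<Rightarrow> real" where
  "cube_expectation n g = measure_pmf.expectation (pmf_of_set (cube n)) g"

definition fourier_coeff :: "nat \<Rightarrow> ((nat \<Rightarrow> real) \<Rightarrow> real) \<Rightarrow> nat set \<Rightarrow> real" where
  "fourier_coeff n f S = cube_expectation n (\<lambda>x. f x * (\<Prod>i\<in>S. x i))"

definition level1_weight :: "nat \<Rightarrow> ((nat \<Rightarrow> real) \<Rightarrow> real) \<Rightarrow> real" where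
  "level1_weight n f = (\<Sum>i=1..n. (fourier_coeff n f {i})\<^sup>2)"

(* Only the entries a 1, ..., a n are used, so a :: nat => real stands for a vector in R^n. *)
definition halfspace :: "nat \<Rightarrow> (nat \<Rightarrow> real) \<Rightarrow> real \<Rightarrow> (nat \<Rightarrow> real) \<Rightarrow> real" where
  "halfspace n a t x = of_bool ((\<Sum>i=1..n. a i * x i) > t)"

(* The expression p^2 log (1/p), with the explicit convention that it is 0 at p = 0. *)
definition sq_log_inv :: "real \<Rightarrow> real" where
  "sq_log_inv p = (if p = 0 then 0 else p\<^sup>2 * ln (1 / p))"

end

theory Submission
  imports Defs
begin

text \<open>
  Write \<open>\<mu>\<close> for the measure of the halfspace \<open>f = 1{X > t}\<close>, where
  \<open>X = \<langle>a, x\<rangle>\<close>, and put \<open>k = log (1 / \<mu>)\<close>. The vector \<open>v\<close> of level-1 Fourier coefficients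
  satisfies \<open>\<langle>b, v\<rangle> = E[f \<langle>b, x\<rangle>]\<close> for every vector \<open>b\<close>, so everything is about how large a
  linear form can be on average over the halfspace.

  For the upper bound, take \<open>b = v / \<mu>\<close>. Jensen's inequality on the support of \<open>f\<close> and the
  subgaussian bound \<open>E exp \<langle>b, x\<rangle> \<le> exp (|b|^2 / 2)\<close> give
  \<open>\<mu> exp (|v|^2 / \<mu>^2) \<le> exp (|v|^2 / (2 \<mu>^2))\<close>, and taking logarithms yields the constant 2
  (\<open>level1_inequality\<close>).

  For the lower bound with large \<open>k\<close>, Cauchy-Schwarz asks for a vector \<open>b\<close> with
  \<open>E[f \<langle>b, x\<rangle>] \<ge> c \<mu> sqrt k |b|\<close>. The choice \<open>b = a\<close> fails when a few entries of \<open>a\<close> dominate.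
  Truncation repairs this: let \<open>b\<close> be \<open>s a\<close> with its entries clamped to \<open>[-1, 1]\<close>, and choose the
  scale \<open>s\<close> such that \<open>|b|^2 = L = k / 4\<close> (\<open>clamp_mass_ivt\<close>). Two facts make this \<open>b\<close> work.
  First, by an exponentially tilted second moment argument the event that every clamped coordinate
  agrees in sign with \<open>a\<close> and that \<open>\<langle>b, x\<rangle> \<ge> L / 4 - 1\<close> has probability at least
  \<open>exp (- 2 L) / 4 > \<mu>\<close>, so it contains a point \<open>x\<close> outside the halfspace
  (\<open>tilted_point_outside\<close>). Second, \<open>\<langle>s a - b, x\<rangle>\<close> is as large as it can be at this \<open>x\<close>, because
  \<open>s a - b\<close> lives on the clamped coordinates. Any \<open>y\<close> in the halfspace has
  \<open>\<langle>s a, y\<rangle> \<ge> \<langle>s a, x\<rangle>\<close>; subtracting \<open>\<langle>s a - b, y\<rangle> \<le> \<langle>s a - b, x\<rangle>\<close> leaves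
  \<open>\<langle>b, y\<rangle> \<ge> \<langle>b, x\<rangle> \<ge> L / 4 - 1\<close> (\<open>truncated_form_ge_on_halfspace\<close>). So \<open>\<langle>b, x\<rangle>\<close> is of order
  \<open>k\<close>, that is of order \<open>sqrt k |b|\<close>, at every single point of the halfspace.

  For bounded \<open>k\<close> it suffices that \<open>|v| \<ge> c \<mu>\<close>. Here \<open>b = a\<close> works: since \<open>f\<close> prefers large \<open>|X|\<close>
  once \<open>x\<close> and \<open>-x\<close> are paired, \<open>E[f X] \<ge> \<mu> E|X|\<close>, and \<open>E|X| \<ge> c |a|\<close> by Khinchine's inequality.
\<close>

section \<open>Expectations over the cube\<close>

definition linear_form :: "nat \<Rightarrow> (nat \<Rightarrow> real) \<Rightarrow> (nat \<Rightarrow> real) \<Rightarrow> real" where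
  "linear_form n b x = (\<Sum>i=1..n. b i * x i)"

lemma finite_cube: "finite (cube n)"
  unfolding cube_def by (intro finite_PiE) auto

lemma card_cube: "card (cube n) = 2 ^ n"
  unfolding cube_def by (subst card_PiE) (auto simp: card_insert_if numeral_2_eq_2)

lemma cube_coord: "x \<in> cube n \<Longrightarrow> i \<in> {1..n} \<Longrightarrow> x i = 1 \<or> x i = -1"
  unfolding cube_def by auto

lemma cube_expectation_eq_sum: "cube_expectation n g = (\<Sum>x\<in>cube n. g x) / 2 ^ n"
proof -
  have "cube n \<noteq> {}"
    using card_cube[of n] by (metis card.empty power_not_zero zero_neq_numeral)
  then show ?thesis
    unfolding cube_expectation_def by (subst integral_pmf_of_set) (auto simp: finite_cube card_cube)
qed

lemma cube_expectation_add:
  "cube_expectation n (\<lambda>x. g x + h x) = cube_expectation n g + cube_expectation n h"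
  by (simp add: cube_expectation_eq_sum sum.distrib add_divide_distrib)

lemma cube_expectation_diff:
  "cube_expectation n (\<lambda>x. g x - h x) = cube_expectation n g - cube_expectation n h"
  by (simp add: cube_expectation_eq_sum sum_subtractf diff_divide_distrib)

lemma cube_expectation_cmult: "cube_expectation n (\<lambda>x. c * g x) = c * cube_expectation n g"
  by (simp add: cube_expectation_eq_sum sum_distrib_left)

lemma cube_expectation_const: "cube_expectation n (\<lambda>x. c) = c"
  by (simp add: cube_expectation_eq_sum card_cube)

lemma cube_expectation_sum:
  "cube_expectation n (\<lambda>x. \<Sum>i\<in>I. g i x) = (\<Sum>i\<in>I. cube_expectation n (g i))"
  unfolding cube_expectation_eq_sum
  by (subst sum.swap) (simp add: sum_divide_distrib)

lemma cube_expectation_mono: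
  assumes "\<And>x. x \<in> cube n \<Longrightarrow> g x \<le> h x"
  shows "cube_expectation n g \<le> cube_expectation n h"
  unfolding cube_expectation_eq_sum by (intro divide_right_mono sum_mono assms) auto

lemma cube_expectation_cong:
  assumes "\<And>x. x \<in> cube n \<Longrightarrow> g x = h x"
  shows "cube_expectation n g = cube_expectation n h"
  unfolding cube_expectation_eq_sum using assms by simp

lemma cube_expectation_nonneg:
  assumes "\<And>x. x \<in> cube n \<Longrightarrow> 0 \<le> g x"
  shows "0 \<le> cube_expectation n g"
  unfolding cube_expectation_eq_sum by (intro divide_nonneg_nonneg sum_nonneg assms) auto

text \<open>
  This is independence of the coordinates. Every exponential moment below, and also the measure of
  a subcube, is computed from it.
\<close>

lemma cube_expectation_prod:
  "cube_expectation n (\<lambda>x. \<Prod>i=1..n. w i (x i)) = (\<Prod>i=1..n. (w i 1 + w i (-1)) / 2)"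
proof -
  have "(\<Sum>x\<in>cube n. \<Prod>i=1..n. w i (x i)) = (\<Prod>i=1..n. \<Sum>y\<in>{-1,1}. w i y)"
    unfolding cube_def by (rule prod_sum_PiE[symmetric]) auto
  also have "\<dots> = (\<Prod>i=1..n. w i 1 + w i (-1))"
    by (intro prod.cong) auto
  finally show ?thesis
    by (simp add: cube_expectation_eq_sum prod_dividef)
qed

lemma cube_expectation_reflect:
  "cube_expectation n (\<lambda>x. g (\<lambda>i\<in>{1..n}. - x i)) = cube_expectation n g"
proof -
  have "(\<Sum>x\<in>cube n. g (\<lambda>i\<in>{1..n}. - x i)) = (\<Sum>x\<in>cube n. g x)"
  proof (rule sum.reindex_bij_witness
      [where i = "\<lambda>x. \<lambda>i\<in>{1..n}. - x i" and j = "\<lambda>x. \<lambda>i\<in>{1..n}. - x i"])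
    fix x assume x: "x \<in> cube n"
    then show "(\<lambda>i\<in>{1..n}. - (\<lambda>i\<in>{1..n}. - x i) i) = x"
      by (auto simp: cube_def PiE_def extensional_def)
    then show "(\<lambda>i\<in>{1..n}. - (\<lambda>i\<in>{1..n}. - x i) i) = x" .
    show "(\<lambda>i\<in>{1..n}. - x i) \<in> cube n"
      using cube_coord[OF x] by (auto simp: cube_def)
    then show "(\<lambda>i\<in>{1..n}. - x i) \<in> cube n" .
  qed simp
  then show ?thesis by (simp add: cube_expectation_eq_sum)
qed

lemma linear_form_reflect: "linear_form n b (\<lambda>i\<in>{1..n}. - x i) = - linear_form n b x"
  by (simp add: linear_form_def sum_negf)

lemma cube_expectation_Cauchy_Schwarz:
  "(cube_expectation n (\<lambda>x. g x * h x))\<^sup>2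
     \<le> cube_expectation n (\<lambda>x. (g x)\<^sup>2) * cube_expectation n (\<lambda>x. (h x)\<^sup>2)"
proof -
  have "(\<Sum>x\<in>cube n. g x * h x)\<^sup>2 \<le> (\<Sum>x\<in>cube n. (g x)\<^sup>2) * (\<Sum>x\<in>cube n. (h x)\<^sup>2)"
    by (rule Cauchy_Schwarz_ineq_sum)
  then have "(\<Sum>x\<in>cube n. g x * h x)\<^sup>2 / (2 ^ n * 2 ^ n)
      \<le> (\<Sum>x\<in>cube n. (g x)\<^sup>2) * (\<Sum>x\<in>cube n. (h x)\<^sup>2) / (2 ^ n * 2 ^ n)"
    by (intro divide_right_mono) auto
  then show ?thesis
    unfolding cube_expectation_eq_sum power_divide times_divide_times_eq
    by (simp only: power2_eq_square[of "2 ^ n"])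
qed

section \<open>Exponential moments of linear forms\<close>

text \<open>
  The logarithm of \<open>cosh\<close> is the cumulant function of a uniform sign, so this is Hoeffding's lemma
  for a variable with values in an interval of length 2.
\<close>

lemma cosh_le_exp_half_square: "cosh u \<le> exp (u\<^sup>2 / 2)" for u :: real
proof -
  have "- (2 * \<bar>u\<bar>) * (1/2) + ln (1 + 1/2 * (exp (2 * \<bar>u\<bar>) - 1)) \<le> (2 * \<bar>u\<bar>)\<^sup>2 / 8"
    by (rule Hoeffdings_lemma_aux) auto
  then have "ln (1 + 1/2 * (exp (2 * \<bar>u\<bar>) - 1)) \<le> \<bar>u\<bar> + u\<^sup>2 / 2"
    by (simp add: power_mult_distrib)
  moreover have p: "1 + 1/2 * (exp (2 * \<bar>u\<bar>) - 1) > 0"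
    by (rule add_pos_nonneg) auto
  ultimately have "1 + 1/2 * (exp (2 * \<bar>u\<bar>) - 1) \<le> exp (\<bar>u\<bar> + u\<^sup>2 / 2)"
    by (metis exp_le_cancel_iff exp_ln)
  moreover have "1 + 1/2 * (exp (2 * \<bar>u\<bar>) - 1) = exp \<bar>u\<bar> * cosh \<bar>u\<bar>"
  proof -
    have "exp \<bar>u\<bar> * exp (- \<bar>u\<bar>) = 1" by (simp flip: exp_add)
    then show ?thesis
      unfolding cosh_field_def exp_double power2_eq_square by algebra
  qed
  ultimately have "exp \<bar>u\<bar> * cosh \<bar>u\<bar> \<le> exp \<bar>u\<bar> * exp (u\<^sup>2 / 2)"
    by (simp add: exp_add)
  then show ?thesis by simp
qed

lemma sinh_ge_self: "v \<le> sinh v" if "0 \<le> v" for v :: real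
proof -
  have A: "1 + v + v\<^sup>2 / 2 \<le> exp v"
    by (rule exp_lower_Taylor_quadratic[OF that])
  have p: "0 < 1 - v + v\<^sup>2 / 2"
    using zero_le_power2[of "v - 1"] by (simp add: power2_eq_square algebra_simps)
  have "1 \<le> (1 - v + v\<^sup>2 / 2) * (1 + v + v\<^sup>2 / 2)"
    using zero_le_power2[of "v\<^sup>2"] by (simp add: power2_eq_square algebra_simps)
  also have "\<dots> \<le> (1 - v + v\<^sup>2 / 2) * exp v"
    using A p by (intro mult_left_mono) auto
  finally have "exp (- v) \<le> 1 - v + v\<^sup>2 / 2"
    by (simp add: exp_minus field_simps)
  with A show ?thesis by (simp add: sinh_field_def)
qed

text \<open>
  The converse Gaussian bound, with a worse constant, needs \<open>u\<close> bounded. Clamped vectors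
  and unit vectors have entries in this range.
\<close>

lemma exp_quarter_square_le_cosh: "exp (u\<^sup>2 / 4) \<le> cosh u" if "\<bar>u\<bar> \<le> 1" for u :: real
proof -
  have u1: "u\<^sup>2 \<le> 1" using that by (simp add: abs_square_le_1)
  have "exp (u\<^sup>2 / 4) \<le> 1 + 2 * (u\<^sup>2 / 4)"
    using u1 by (intro real_exp_bound_lemma) auto
  also have "\<dots> = 1 + 2 * \<bar>u / 2\<bar>\<^sup>2"
    by (simp add: power_divide)
  also have "\<dots> \<le> 1 + 2 * (sinh \<bar>u / 2\<bar>)\<^sup>2"
    using sinh_ge_self[of "\<bar>u/2\<bar>"] by (intro add_mono mult_left_mono power_mono) auto
  also have "\<dots> = cosh (2 * \<bar>u / 2\<bar>)"
    by (simp only: cosh_double cosh_square_eq)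
  finally show ?thesis by simp
qed

lemma exp_linear_form: "exp (linear_form n b x) = (\<Prod>i=1..n. exp (b i * x i))"
  by (simp add: linear_form_def exp_sum)

lemma expectation_exp_linear_form:
  "cube_expectation n (\<lambda>x. exp (linear_form n b x)) = (\<Prod>i=1..n. cosh (b i))"
  unfolding exp_linear_form using cube_expectation_prod[of n "\<lambda>i y. exp (b i * y)"]
  by (simp add: cosh_field_def)

lemma expectation_exp_linear_form_le:
  "cube_expectation n (\<lambda>x. exp (linear_form n b x)) \<le> exp ((\<Sum>i=1..n. (b i)\<^sup>2) / 2)"
  unfolding expectation_exp_linear_form sum_divide_distrib exp_sum[OF finite_atLeastAtMost]
  by (intro prod_mono) (auto simp: cosh_le_exp_half_square)

lemma expectation_exp_linear_form_ge:
  assumes "\<And>i. i \<in> {1..n} \<Longrightarrow> \<bar>b i\<bar> \<le> 1"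
  shows "exp ((\<Sum>i=1..n. (b i)\<^sup>2) / 4) \<le> cube_expectation n (\<lambda>x. exp (linear_form n b x))"
  unfolding expectation_exp_linear_form sum_divide_distrib exp_sum[OF finite_atLeastAtMost]
proof (rule prod_mono)
  fix i assume "i \<in> {1..n}"
  with assms show "0 \<le> exp ((b i)\<^sup>2 / 4) \<and> exp ((b i)\<^sup>2 / 4) \<le> cosh (b i)"
    using exp_quarter_square_le_cosh by simp
qed

section \<open>The level-1 weight\<close>

lemma expectation_linear_form:
  "cube_expectation n (\<lambda>x. f x * linear_form n b x) = (\<Sum>i=1..n. b i * fourier_coeff n f {i})"
proof -
  have "f x * linear_form n b x = (\<Sum>i=1..n. b i * (f x * (\<Prod>j\<in>{i}. x j)))" for x
    by (simp add: linear_form_def sum_distrib_left algebra_simps)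
  then show ?thesis
    by (simp only: cube_expectation_sum cube_expectation_cmult fourier_coeff_def)
qed

lemma expectation_linear_form_square_le:
  "(cube_expectation n (\<lambda>x. f x * linear_form n b x))\<^sup>2
     \<le> (\<Sum>i=1..n. (b i)\<^sup>2) * level1_weight n f"
  unfolding expectation_linear_form level1_weight_def by (rule Cauchy_Schwarz_ineq_sum)

text \<open>
  Jensen's inequality for the measure with density proportional to \<open>f\<close>: integrate the tangent to
  \<open>exp\<close> at the mean of \<open>z\<close>.
\<close>

lemma exp_Jensen:
  assumes f: "\<And>x. x \<in> cube n \<Longrightarrow> 0 \<le> f x" and pos: "0 < cube_expectation n f"
  shows "cube_expectation n f * exp (cube_expectation n (\<lambda>x. f x * z x) / cube_expectation n f)
           \<le> cube_expectation n (\<lambda>x. f x * exp (z x))"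
proof -
  define \<mu> where "\<mu> = cube_expectation n f"
  define m where "m = cube_expectation n (\<lambda>x. f x * z x) / \<mu>"
  have "cube_expectation n (\<lambda>x. exp m * (1 - m) * f x + exp m * (f x * z x))
          \<le> cube_expectation n (\<lambda>x. f x * exp (z x))"
  proof (rule cube_expectation_mono)
    fix x assume x: "x \<in> cube n"
    have "exp m * (1 + (z x - m)) \<le> exp m * exp (z x - m)"
      by (intro mult_left_mono exp_ge_add_one_self) auto
    then have "exp m * (1 + (z x - m)) \<le> exp (z x)"
      by (simp flip: exp_add)
    from mult_left_mono[OF this f[OF x]]
    show "exp m * (1 - m) * f x + exp m * (f x * z x) \<le> f x * exp (z x)"
      by (simp add: algebra_simps)
  qed
  moreover have "cube_expectation n (\<lambda>x. exp m * (1 - m) * f x + exp m * (f x * z x)) = \<mu> * exp m"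
    using pos unfolding cube_expectation_add cube_expectation_cmult
    by (simp add: m_def \<mu>_def field_simps)
  ultimately show ?thesis by (simp add: m_def \<mu>_def)
qed

text \<open>
  Testing against the level-1 part itself, scaled by \<open>1 / \<mu>\<close>: this scale optimises the exponent
  \<open>\<lambda> W / \<mu> - \<lambda>\<^sup>2 W / 2\<close> obtained from a general multiple \<open>\<lambda>\<close>, and is what produces the constant 2.
\<close>

lemma level1_inequality:
  assumes f: "\<And>x. x \<in> cube n \<Longrightarrow> 0 \<le> f x \<and> f x \<le> 1"
  shows "level1_weight n f \<le> 2 * sq_log_inv (cube_expectation n f)"
proof (cases "cube_expectation n f = 0")
  case True
  then have "(\<Sum>x\<in>cube n. f x) = 0"
    by (simp add: cube_expectation_eq_sum)
  then have "\<forall>x\<in>cube n. f x = 0"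
    using f by (subst (asm) sum_nonneg_eq_0_iff) (auto simp: finite_cube)
  then have "level1_weight n f = 0"
    by (simp add: level1_weight_def fourier_coeff_def cube_expectation_eq_sum)
  then show ?thesis using True by (simp add: sq_log_inv_def)
next
  case False
  define \<mu> where "\<mu> = cube_expectation n f"
  define W where "W = level1_weight n f"
  define b where "b = (\<lambda>i. fourier_coeff n f {i} / \<mu>)"
  have mu: "0 < \<mu>"
    using False cube_expectation_nonneg[of n f] f by (force simp: \<mu>_def)
  have Eb: "cube_expectation n (\<lambda>x. f x * linear_form n b x) = W / \<mu>"
    unfolding expectation_linear_form by (simp add: W_def level1_weight_def b_def power2_eq_square
        sum_divide_distrib)
  have Sb: "(\<Sum>i=1..n. (b i)\<^sup>2) = W / \<mu>\<^sup>2"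
    by (simp add: W_def level1_weight_def b_def power_divide sum_divide_distrib)
  have "\<mu> * exp (W / \<mu>\<^sup>2) \<le> cube_expectation n (\<lambda>x. f x * exp (linear_form n b x))"
    using exp_Jensen[of n f "linear_form n b"] f mu unfolding Eb
    by (simp add: \<mu>_def power2_eq_square)
  also have "\<dots> \<le> cube_expectation n (\<lambda>x. exp (linear_form n b x))"
    using f by (intro cube_expectation_mono) (simp add: mult_left_le_one_le)
  also have "\<dots> \<le> exp (W / \<mu>\<^sup>2 / 2)"
    using expectation_exp_linear_form_le[of n b] unfolding Sb .
  finally have "ln (\<mu> * exp (W / \<mu>\<^sup>2)) \<le> W / \<mu>\<^sup>2 / 2"
    using mu by (subst ln_exp[symmetric]) (intro ln_mono, auto)
  then have "ln \<mu> + W / \<mu>\<^sup>2 \<le> W / \<mu>\<^sup>2 / 2"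
    using mu by (simp add: ln_mult_pos)
  then have "W / \<mu>\<^sup>2 \<le> 2 * ln (1 / \<mu>)"
    using mu by (simp add: ln_div)
  then have "W \<le> 2 * (\<mu>\<^sup>2 * ln (1 / \<mu>))"
    using mu by (simp add: field_simps)
  then show ?thesis
    using mu by (simp add: sq_log_inv_def W_def \<mu>_def)
qed

section \<open>Halfspaces of small measure\<close>

text \<open>
  The random variable \<open>V\<close> is \<open>exp \<langle>b, x\<rangle>\<close> cut down to the subcube on which the coordinates with
  \<open>\<bar>b i\<bar> = 1\<close> agree with \<open>b\<close>. It is a product of independent factors, each of mean at least
  \<open>exp ((b i)\<^sup>2 / 4)\<close> and with second moment at most \<open>exp (2 (b i)\<^sup>2)\<close> times its squared mean. By
  the argument of Paley and Zygmund, a set that contains \<open>{V \<ge> E V / 2}\<close> has measure at least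
  \<open>exp (- 2 L) / 4\<close>; hence a smaller set misses some such point, and there \<open>V > 0\<close> gives the signs
  and the size of \<open>V\<close> bounds \<open>\<langle>b, x\<rangle>\<close>.
\<close>

lemma tilted_point_outside:
  assumes b: "\<And>i. i \<in> {1..n} \<Longrightarrow> \<bar>b i\<bar> \<le> 1"
    and L: "L = (\<Sum>i=1..n. (b i)\<^sup>2)"
    and f01: "\<And>x. x \<in> cube n \<Longrightarrow> f x = 0 \<or> f x = 1"
    and small: "cube_expectation n f < exp (- 2 * L) / 4"
  obtains x where "x \<in> cube n" "f x = 0" "L / 4 - 1 \<le> linear_form n b x"
    "\<And>i. i \<in> {1..n} \<Longrightarrow> \<bar>b i\<bar> = 1 \<Longrightarrow> x i = b i"
proof -
  define w where "w = (\<lambda>i y. if \<bar>b i\<bar> = 1 \<and> y \<noteq> b i then 0 else exp (b i * y))"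
  define V where "V = (\<lambda>x. \<Prod>i=1..n. w i (x i))"
  define EV where "EV = cube_expectation n V"
  have w_cases: "w i 1 + w i (-1) = exp 1 \<and> (w i 1)\<^sup>2 + (w i (-1))\<^sup>2 = (exp 1)\<^sup>2"
    if "\<bar>b i\<bar> = 1" for i
    using that by (auto simp: w_def abs_if split: if_splits)
  have w_cases': "w i 1 + w i (-1) = 2 * cosh (b i) \<and> (w i 1)\<^sup>2 + (w i (-1))\<^sup>2 = 2 * cosh (2 * b i)"
    if "\<bar>b i\<bar> \<noteq> 1" for i
    using that by (simp add: w_def cosh_field_def power2_eq_square flip: exp_add)
  have mean_ge: "exp ((b i)\<^sup>2 / 4) \<le> (w i 1 + w i (-1)) / 2" if i: "i \<in> {1..n}" for i
  proof (cases "\<bar>b i\<bar> = 1")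
    case True
    \<comment> \<open>The mean is \<open>e / 2\<close>, since only one of the two signs survives the cut.\<close>
    have "2 \<le> exp (3/4 :: real)"
      using exp_lower_Taylor_quadratic[of "3/4"] by (simp add: power2_eq_square)
    then have "2 * exp (1/4) \<le> exp (3/4) * exp (1/4 :: real)" by simp
    also have "\<dots> = exp 1" by (simp flip: exp_add)
    finally have "exp (1/4) \<le> exp 1 / (2 :: real)" by simp
    moreover have "(b i)\<^sup>2 = 1" using True by (metis one_power2 power2_abs)
    ultimately show ?thesis using w_cases[OF True] by simp
  next
    case False
    then show ?thesis using w_cases' exp_quarter_square_le_cosh[OF b[OF i]] by simp
  qed
  have ratio: "((w i 1)\<^sup>2 + (w i (-1))\<^sup>2) / 2 \<le> exp (2 * (b i)\<^sup>2) * ((w i 1 + w i (-1)) / 2)\<^sup>2"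
    if i: "i \<in> {1..n}" for i
  proof (cases "\<bar>b i\<bar> = 1")
    case True
    have b2: "(b i)\<^sup>2 = 1" using True by (metis one_power2 power2_abs)
    have "2 * (exp 1)\<^sup>2 \<le> exp 2 * (exp 1 :: real)\<^sup>2"
      using exp_ge_add_one_self[of "2::real"] by (intro mult_right_mono) auto
    then show ?thesis using w_cases[OF True] by (simp add: b2 power_divide)
  next
    case False
    have "cosh (2 * b i) * 1 \<le> exp (2 * (b i)\<^sup>2) * (cosh (b i))\<^sup>2"
      using cosh_le_exp_half_square[of "2 * b i"] cosh_real_ge_1[of "b i"]
      by (intro mult_mono) (auto simp: power_mult_distrib)
    then show ?thesis using w_cases'[OF False] by simp
  qed
  have EV_prod: "EV = (\<Prod>i=1..n. (w i 1 + w i (-1)) / 2)"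
    unfolding EV_def V_def by (rule cube_expectation_prod)
  have EV_ge: "exp (L / 4) \<le> EV"
    unfolding EV_prod L sum_divide_distrib exp_sum[OF finite_atLeastAtMost]
    by (intro prod_mono) (use mean_ge in auto)
  have EV_pos: "0 < EV" using EV_ge by (smt (verit) exp_gt_zero)
  have "cube_expectation n (\<lambda>x. (V x)\<^sup>2) = (\<Prod>i=1..n. ((w i 1)\<^sup>2 + (w i (-1))\<^sup>2) / 2)"
    unfolding V_def prod_power_distrib by (rule cube_expectation_prod)
  also have "\<dots> \<le> (\<Prod>i=1..n. exp (2 * (b i)\<^sup>2) * ((w i 1 + w i (-1)) / 2)\<^sup>2)"
    by (intro prod_mono) (use ratio in auto)
  also have "\<dots> = exp (2 * L) * EV\<^sup>2"
    unfolding EV_prod L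
    by (simp only: prod.distrib prod_power_distrib sum_distrib_left exp_sum[OF finite_atLeastAtMost])
  finally have EV2: "cube_expectation n (\<lambda>x. (V x)\<^sup>2) \<le> exp (2 * L) * EV\<^sup>2" .
  have "\<exists>x\<in>cube n. f x = 0 \<and> EV / 2 \<le> V x"
  proof (rule ccontr)
    assume neg: "\<not> ?thesis"
    \<comment> \<open>Off the support of \<open>f\<close> the values of \<open>V\<close> are below half the mean, so the support
        carries the other half.\<close>
    have "EV \<le> cube_expectation n (\<lambda>x. V x * f x + EV / 2)"
      unfolding EV_def
    proof (rule cube_expectation_mono, fold EV_def)
      fix x assume "x \<in> cube n"
      then show "V x \<le> V x * f x + EV / 2"
        using neg f01[of x] EV_pos by force
    qed
    then have "EV / 2 \<le> cube_expectation n (\<lambda>x. V x * f x)"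
      by (simp add: cube_expectation_add cube_expectation_const)
    then have "(EV / 2)\<^sup>2 \<le> (cube_expectation n (\<lambda>x. V x * f x))\<^sup>2"
      using EV_pos by (intro power_mono) auto
    also have "\<dots> \<le> cube_expectation n (\<lambda>x. (V x)\<^sup>2) * cube_expectation n (\<lambda>x. (f x)\<^sup>2)"
      by (rule cube_expectation_Cauchy_Schwarz)
    also have "cube_expectation n (\<lambda>x. (f x)\<^sup>2) = cube_expectation n f"
      by (rule cube_expectation_cong) (use f01 in force)
    also have "cube_expectation n (\<lambda>x. (V x)\<^sup>2) * cube_expectation n f
        \<le> exp (2 * L) * EV\<^sup>2 * cube_expectation n f"
      by (intro mult_right_mono EV2 cube_expectation_nonneg) (use f01 in force)
    also have "\<dots> < exp (2 * L) * EV\<^sup>2 * (exp (- 2 * L) / 4)"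
      using small EV_pos by (intro mult_strict_left_mono) auto
    also have "\<dots> = (EV / 2)\<^sup>2"
      by (simp add: exp_minus power_divide)
    finally show False by simp
  qed
  then obtain x where x: "x \<in> cube n" "f x = 0" "EV / 2 \<le> V x" by blast
  have nz: "w i (x i) \<noteq> 0" if "i \<in> {1..n}" for i
    using x(3) EV_pos that unfolding V_def by (metis finite_atLeastAtMost half_gt_zero not_less prod_zero_iff)
  have "V x = exp (linear_form n b x)"
    unfolding V_def exp_linear_form
  proof (intro prod.cong refl)
    fix i assume "i \<in> {1..n}"
    from nz[OF this] show "w i (x i) = exp (b i * x i)"
      by (auto simp: w_def split: if_splits)
  qed
  moreover have "exp (L / 4 - 1) \<le> EV / 2"
  proof -
    have "exp (L / 4 - 1) * 2 \<le> exp (L / 4 - 1) * exp 1"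
      using exp_ge_add_one_self[of "1::real"] by (intro mult_left_mono) auto
    also have "\<dots> = exp (L / 4)" by (simp flip: exp_add)
    finally show ?thesis using EV_ge by simp
  qed
  ultimately have "exp (L / 4 - 1) \<le> exp (linear_form n b x)"
    using x(3) by linarith
  then have large: "L / 4 - 1 \<le> linear_form n b x" by simp
  have "x i = b i" if "i \<in> {1..n}" "\<bar>b i\<bar> = 1" for i
    using nz[OF that(1)] that(2) by (auto simp: w_def split: if_splits)
  then show ?thesis by (rule that[OF x(1,2) large])
qed

lemma halfspace_eq: "halfspace n a t x = of_bool (linear_form n a x > t)"
  by (simp add: halfspace_def linear_form_def)

text \<open>
  A nonempty halfspace contains the subcube through one of its points in which all the relevant
  coordinates are fixed. Therefore \<open>\<mu>\<close> can be small only if \<open>a\<close> has many nonzero entries, which is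
  what makes the truncation of mass \<open>k / 4\<close> possible.
\<close>

lemma halfspace_expectation_ge:
  assumes "0 < cube_expectation n (halfspace n a t)"
  shows "(1/2) ^ card {i\<in>{1..n}. a i \<noteq> 0} \<le> cube_expectation n (halfspace n a t)"
proof -
  have "\<exists>z\<in>cube n. halfspace n a t z \<noteq> 0"
  proof (rule ccontr)
    assume "\<not> ?thesis"
    then have "cube_expectation n (halfspace n a t) = 0"
      by (simp add: cube_expectation_eq_sum)
    with assms show False by simp
  qed
  then obtain z where z: "z \<in> cube n" "linear_form n a z > t"
    by (auto simp: halfspace_eq)
  define w where "w = (\<lambda>i y. if a i \<noteq> 0 \<and> y \<noteq> z i then 0 else 1 :: real)"
  have "(\<Prod>i=1..n. (w i 1 + w i (-1)) / 2) = (\<Prod>i=1..n. if a i \<noteq> 0 then 1/2 else 1)"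
    by (intro prod.cong refl) (use cube_coord[OF z(1)] in \<open>force simp: w_def\<close>)
  also have "\<dots> = (1/2) ^ card {i\<in>{1..n}. a i \<noteq> 0}"
    by (simp add: prod.If_cases Int_def)
  finally have "(1/2) ^ card {i\<in>{1..n}. a i \<noteq> 0} = cube_expectation n (\<lambda>x. \<Prod>i=1..n. w i (x i))"
    by (simp only: cube_expectation_prod)
  also have "\<dots> \<le> cube_expectation n (halfspace n a t)"
  proof (rule cube_expectation_mono)
    fix x assume "x \<in> cube n"
    show "(\<Prod>i=1..n. w i (x i)) \<le> halfspace n a t x"
    proof (cases "\<forall>i\<in>{1..n}. w i (x i) \<noteq> 0")
      case True
      then have "linear_form n a x = linear_form n a z"
        unfolding linear_form_def by (intro sum.cong refl) (auto simp: w_def split: if_splits)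
      moreover have "(\<Prod>i=1..n. w i (x i)) = 1"
        using True by (intro prod.neutral) (auto simp: w_def split: if_splits)
      ultimately show ?thesis using z(2) by (simp add: halfspace_eq)
    next
      case False
      then have "(\<Prod>i=1..n. w i (x i)) = 0" by (subst prod_zero_iff) auto
      also have "0 \<le> halfspace n a t x" by (simp add: halfspace_eq)
      finally show ?thesis .
    qed
  qed
  finally show ?thesis .
qed

text \<open>
  The squared length of the clamped vector grows continuously from 0 at \<open>s = 0\<close> to the number of
  nonzero entries of \<open>a\<close>, which it attains as soon as all of them are clamped.
\<close>

lemma clamp_mass_ivt:
  fixes a :: "nat \<Rightarrow> real" and L :: real
  assumes "0 \<le> L" "L \<le> card {i\<in>{1..n}. a i \<noteq> 0}"
  obtains s where "0 \<le> s" "(\<Sum>i=1..n. (max (-1) (min 1 (s * a i)))\<^sup>2) = L"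
proof -
  define M where "M = (\<lambda>s. \<Sum>i=1..n. (max (-1) (min 1 (s * a i)))\<^sup>2)"
  define N where "N = {i\<in>{1..n}. a i \<noteq> 0}"
  \<comment> \<open>Any scale above all \<open>1 / \<bar>a i\<bar>\<close> clamps every entry; the sum avoids a maximum over a
      possibly empty set.\<close>
  define T where "T = (\<Sum>i\<in>N. 1 / \<bar>a i\<bar>)"
  have T0: "0 \<le> T" unfolding T_def by (intro sum_nonneg) auto
  have big: "1 \<le> T * \<bar>a i\<bar>" if "i \<in> N" for i
  proof -
    have "1 / \<bar>a i\<bar> \<le> T"
      unfolding T_def using that by (intro member_le_sum) (auto simp: N_def)
    then show ?thesis using that by (simp add: N_def field_simps)
  qed
  have "M T = (\<Sum>i=1..n. if a i \<noteq> 0 then 1 else 0)"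
    unfolding M_def
  proof (intro sum.cong refl)
    fix i assume i: "i \<in> {1..n}"
    show "(max (-1) (min 1 (T * a i)))\<^sup>2 = (if a i \<noteq> 0 then 1 else 0)"
    proof (cases "a i = 0")
      case False
      then have "1 \<le> \<bar>T * a i\<bar>"
        using big[of i] i T0 by (simp add: N_def abs_mult)
      then have "T * a i \<ge> 1 \<or> T * a i \<le> -1" by linarith
      then show ?thesis using False by (auto simp: max.absorb1 max.absorb2 min.absorb1 min.absorb2)
    qed simp
  qed
  also have "\<dots> = card N"
    by (simp add: N_def sum.If_cases Int_def)
  finally have MT: "L \<le> M T" using assms(2) by (simp add: N_def)
  have "continuous_on {0..T} M"
    unfolding M_def by (intro continuous_intros)
  moreover have "M 0 \<le> L" using assms(1) by (simp add: M_def)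
  ultimately obtain s where "0 \<le> s" "s \<le> T" "M s = L"
    using IVT'[of M 0 L T] MT T0 by auto
  then show ?thesis using that by (simp add: M_def)
qed

text \<open>
  The residual \<open>s a - b\<close> is supported on the clamped coordinates, where it has the signs of \<open>b\<close>, so
  its linear form is maximal at the point \<open>x\<close> of \<open>tilted_point_outside\<close>. As \<open>y\<close> lies in the
  halfspace and \<open>x\<close> does not, what \<open>y\<close> gains over \<open>x\<close> has to come from \<open>b\<close>.
\<close>

lemma truncated_form_ge_on_halfspace:
  assumes s: "0 \<le> s"
    and L: "L = (\<Sum>i=1..n. (max (-1) (min 1 (s * a i)))\<^sup>2)"
    and small: "cube_expectation n (halfspace n a t) < exp (- 2 * L) / 4"
    and y: "y \<in> cube n" "linear_form n a y > t"
  shows "L / 4 - 1 \<le> linear_form n (\<lambda>i. max (-1) (min 1 (s * a i))) y"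
proof -
  define b where "b = (\<lambda>i. max (-1) (min 1 (s * a i)))"
  have b1: "\<bar>b i\<bar> \<le> 1" for i by (auto simp: b_def)
  have Lb: "L = (\<Sum>i=1..n. (b i)\<^sup>2)" by (simp add: L b_def)
  obtain x where x: "x \<in> cube n" "halfspace n a t x = 0" "L / 4 - 1 \<le> linear_form n b x"
    "\<And>i. i \<in> {1..n} \<Longrightarrow> \<bar>b i\<bar> = 1 \<Longrightarrow> x i = b i"
  proof (rule tilted_point_outside[of n b L "halfspace n a t"])
  qed (use b1 Lb small in \<open>auto simp: halfspace_eq\<close>)
  have split: "linear_form n (\<lambda>i. s * a i - b i) z = s * linear_form n a z - linear_form n b z" for z
    by (simp add: linear_form_def sum_subtractf sum_distrib_left algebra_simps)
  have "linear_form n (\<lambda>i. s * a i - b i) y \<le> linear_form n (\<lambda>i. s * a i - b i) x"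
    unfolding linear_form_def
  proof (rule sum_mono)
    fix i assume i: "i \<in> {1..n}"
    show "(s * a i - b i) * y i \<le> (s * a i - b i) * x i"
    proof (cases "\<bar>b i\<bar> = 1")
      case True
      then have "(b i = 1 \<and> s * a i \<ge> 1) \<or> (b i = -1 \<and> s * a i \<le> -1)"
        by (auto simp: b_def max_def min_def split: if_splits)
      then show ?thesis
        using x(4)[OF i True] cube_coord[OF y(1) i] by auto
    next
      case False
      then have "b i = s * a i" by (auto simp: b_def max_def min_def split: if_splits)
      then show ?thesis by simp
    qed
  qed
  moreover have "s * linear_form n a x \<le> s * linear_form n a y"
    using x(2) y(2) s by (intro mult_left_mono) (auto simp: halfspace_eq)
  ultimately have "L / 4 - 1 \<le> linear_form n b y"
    using x(3) split[of x] split[of y] by linarith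
  then show ?thesis by (simp only: b_def)
qed

text \<open>
  With \<open>L = k / 4\<close> the requirement \<open>\<mu> < exp (- 2 L) / 4\<close> reads \<open>4 < exp (k / 2)\<close>, and \<open>k \<ge> 32\<close>
  means \<open>L \<ge> 8\<close>, which absorbs the loss of 1 in \<open>L / 4 - 1 \<ge> L / 8\<close>.
\<close>

lemma level1_lower_small_measure:
  assumes pos: "0 < cube_expectation n (halfspace n a t)"
    and k: "k = ln (1 / cube_expectation n (halfspace n a t))" "32 \<le> k"
  shows "(cube_expectation n (halfspace n a t))\<^sup>2 * k / 256 \<le> level1_weight n (halfspace n a t)"
proof -
  define f where "f = halfspace n a t"
  define \<mu> where "\<mu> = cube_expectation n f"
  define L where "L = k / 4"
  have mu: "0 < \<mu>" using pos by (simp add: \<mu>_def f_def)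
  have mu_k: "\<mu> = exp (- k)" using mu by (simp add: k(1) \<mu>_def f_def ln_div)
  define m where "m = card {i\<in>{1..n}. a i \<noteq> 0}"
  have "exp (- real m) \<le> (1/2) ^ m"
  proof -
    have "exp (- 1 :: real) \<le> 1/2"
      using exp_ge_add_one_self[of "1::real"] by (simp add: exp_minus field_simps)
    then have "exp (- 1 :: real) ^ m \<le> (1/2) ^ m" by (intro power_mono) auto
    then show ?thesis by (simp flip: exp_of_nat_mult)
  qed
  also have "\<dots> \<le> exp (- k)"
    using halfspace_expectation_ge[OF pos] mu_k by (simp add: m_def \<mu>_def f_def)
  finally have "k \<le> m" by simp
  then have L0: "0 \<le> L" and Lm: "L \<le> m" using k(2) by (auto simp: L_def)
  obtain s where s: "0 \<le> s" "(\<Sum>i=1..n. (max (-1) (min 1 (s * a i)))\<^sup>2) = L"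
    using clamp_mass_ivt[OF L0 Lm[unfolded m_def]] by blast
  define b where "b = (\<lambda>i. max (-1) (min 1 (s * a i)))"
  have "4 * exp (- k) < exp (- 2 * L)"
  proof -
    have "4 < exp (k / 2)"
      using exp_ge_add_one_self[of "k / 2"] k(2) by linarith
    then have "4 * exp (- k) < exp (k / 2) * exp (- k)" by simp
    also have "\<dots> = exp (- 2 * L)" by (simp add: L_def flip: exp_add)
    finally show ?thesis .
  qed
  then have small: "cube_expectation n (halfspace n a t) < exp (- 2 * L) / 4"
    using mu_k by (simp add: \<mu>_def f_def)
  have "\<mu> * (L / 8) = cube_expectation n (\<lambda>x. (L / 8) * f x)"
    unfolding cube_expectation_cmult \<mu>_def by simp
  also have "\<dots> \<le> cube_expectation n (\<lambda>x. f x * linear_form n b x)"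
  proof (rule cube_expectation_mono)
    fix x assume x: "x \<in> cube n"
    show "(L / 8) * f x \<le> f x * linear_form n b x"
    proof (cases "linear_form n a x > t")
      case True
      have "L / 8 \<le> L / 4 - 1" using k(2) by (simp add: L_def)
      also have "\<dots> \<le> linear_form n b x"
        using truncated_form_ge_on_halfspace[OF s(1) s(2)[symmetric] small x True] by (simp add: b_def)
      finally show ?thesis using True by (simp add: f_def halfspace_eq)
    qed (simp add: f_def halfspace_eq)
  qed
  finally have "(\<mu> * (L / 8))\<^sup>2 \<le> (cube_expectation n (\<lambda>x. f x * linear_form n b x))\<^sup>2"
    using mu L0 by (intro power_mono) auto
  also have "\<dots> \<le> L * level1_weight n f"
    using expectation_linear_form_square_le[of n f b] s(2) by (simp add: b_def)
  finally have "L * (\<mu>\<^sup>2 * L / 64) \<le> L * level1_weight n f"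
    by (simp add: power2_eq_square algebra_simps)
  then have "\<mu>\<^sup>2 * L / 64 \<le> level1_weight n f"
    using k(2) by (subst (asm) mult_le_cancel_left_pos) (auto simp: L_def)
  then show ?thesis by (simp add: L_def \<mu>_def f_def)
qed

section \<open>Halfspaces of large measure\<close>

text \<open>
  Khinchine's inequality from exponential moments alone: \<open>E exp y\<close> exceeds 1 by a constant, while
  \<open>exp y - 1 \<le> \<bar>y\<bar> exp y\<close>. Cauchy-Schwarz in the form
  \<open>(E \<bar>y\<bar> exp y)\<^sup>2 \<le> E \<bar>y\<bar> \<cdot> E (\<bar>y\<bar> exp (2 y))\<close> bounds the excess in terms of \<open>E \<bar>y\<bar>\<close>, because
  the last factor is at most a constant.
\<close>

lemma Khinchine_unit:
  assumes "(\<Sum>i=1..n. (b i)\<^sup>2) = 1"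
  shows "1 / (32 * exp (9 / 2)) \<le> cube_expectation n (\<lambda>x. \<bar>linear_form n b x\<bar>)"
proof -
  define y where "y = linear_form n b"
  define M where "M = cube_expectation n (\<lambda>x. \<bar>y x\<bar>)"
  have M0: "0 \<le> M" unfolding M_def by (intro cube_expectation_nonneg) auto
  have b1: "\<bar>b i\<bar> \<le> 1" if "i \<in> {1..n}" for i
  proof -
    have "(b i)\<^sup>2 \<le> 1"
      unfolding assms[symmetric] using that by (intro member_le_sum) auto
    then show ?thesis by (simp add: abs_square_le_1)
  qed
  have scale: "exp (c * y x) = exp (linear_form n (\<lambda>i. c * b i) x)" for c x
    by (simp add: y_def linear_form_def sum_distrib_left algebra_simps)
  have upper: "cube_expectation n (\<lambda>x. exp (c * y x)) \<le> exp (c\<^sup>2 / 2)" for c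
    using expectation_exp_linear_form_le[of n "\<lambda>i. c * b i"] assms
    by (simp add: scale power_mult_distrib flip: sum_distrib_left)
  have "1 + 1/4 \<le> exp (1 / 4 :: real)" by (rule exp_ge_add_one_self)
  also have "\<dots> \<le> cube_expectation n (\<lambda>x. exp (y x))"
    using expectation_exp_linear_form_ge[of n b] b1 assms by (simp add: y_def)
  finally have "1/4 \<le> cube_expectation n (\<lambda>x. exp (y x) - 1)"
    by (simp add: cube_expectation_diff cube_expectation_const)
  also have "\<dots> \<le> cube_expectation n (\<lambda>x. sqrt \<bar>y x\<bar> * (sqrt \<bar>y x\<bar> * exp (y x)))"
  proof (rule cube_expectation_mono)
    fix x
    have "exp (y x) * (1 - exp (- y x)) \<le> exp (y x) * \<bar>y x\<bar>"
      using exp_ge_add_one_self[of "- y x"] by (intro mult_left_mono) auto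
    then have "exp (y x) - 1 \<le> \<bar>y x\<bar> * exp (y x)"
      by (simp add: right_diff_distrib exp_minus mult.commute)
    then show "exp (y x) - 1 \<le> sqrt \<bar>y x\<bar> * (sqrt \<bar>y x\<bar> * exp (y x))"
      by (simp only: mult.assoc[symmetric] real_sqrt_mult_self abs_idempotent)
  qed
  finally have "(1/4)\<^sup>2 \<le> (cube_expectation n (\<lambda>x. sqrt \<bar>y x\<bar> * (sqrt \<bar>y x\<bar> * exp (y x))))\<^sup>2"
    by (intro power_mono) auto
  also have "\<dots> \<le> cube_expectation n (\<lambda>x. (sqrt \<bar>y x\<bar>)\<^sup>2)
                  * cube_expectation n (\<lambda>x. (sqrt \<bar>y x\<bar> * exp (y x))\<^sup>2)"
    by (rule cube_expectation_Cauchy_Schwarz)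
  also have "\<dots> \<le> M * cube_expectation n (\<lambda>x. exp (3 * y x) + exp (1 * y x))"
    unfolding M_def
  proof (intro mult_mono cube_expectation_mono cube_expectation_nonneg)
    fix x
    have "\<bar>y x\<bar> \<le> exp (y x) + exp (- y x)"
      using exp_ge_add_one_self[of "y x"] exp_ge_add_one_self[of "- y x"] 
        exp_gt_zero[of "y x"] exp_gt_zero[of "- y x"] by linarith
    then have "\<bar>y x\<bar> * exp (2 * y x) \<le> (exp (y x) + exp (- y x)) * exp (2 * y x)"
      by (intro mult_right_mono) auto
    also have "\<dots> = exp (3 * y x) + exp (1 * y x)"
      by (simp add: distrib_right flip: exp_add)
    finally show "(sqrt \<bar>y x\<bar> * exp (y x))\<^sup>2 \<le> exp (3 * y x) + exp (1 * y x)"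
      by (simp add: power_mult_distrib flip: exp_double)
  qed auto
  also have "\<dots> \<le> M * (2 * exp (9 / 2))"
  proof -
    have "cube_expectation n (\<lambda>x. exp (3 * y x)) \<le> exp (9 / 2)"
      using upper[of 3] by simp
    moreover have "cube_expectation n (\<lambda>x. exp (1 * y x)) \<le> exp (9 / 2)"
      using upper[of 1] by (rule order_trans) simp
    ultimately show ?thesis
      using M0 unfolding cube_expectation_add by (intro mult_left_mono) auto
  qed
  finally show ?thesis
    by (simp add: M_def y_def power2_eq_square field_simps)
qed

lemma Khinchine:
  "sqrt (\<Sum>i=1..n. (a i)\<^sup>2) / (32 * exp (9 / 2)) \<le> cube_expectation n (\<lambda>x. \<bar>linear_form n a x\<bar>)"
proof (cases "(\<Sum>i=1..n. (a i)\<^sup>2) = 0")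
  case True
  then show ?thesis by (simp add: cube_expectation_nonneg)
next
  case False
  define r where "r = sqrt (\<Sum>i=1..n. (a i)\<^sup>2)"
  have "0 \<le> (\<Sum>i=1..n. (a i)\<^sup>2)" by (intro sum_nonneg) auto
  with False have r: "0 < r" "r\<^sup>2 = (\<Sum>i=1..n. (a i)\<^sup>2)" by (auto simp: r_def)
  have "(\<Sum>i=1..n. (a i / r)\<^sup>2) = 1"
    using r(1) unfolding power_divide sum_divide_distrib[symmetric] r(2)[symmetric] by simp
  note Khinchine_unit[OF this]
  also have "linear_form n (\<lambda>i. a i / r) x = (1 / r) * linear_form n a x" for x
    by (simp add: linear_form_def sum_divide_distrib)
  then have "(\<lambda>x. \<bar>linear_form n (\<lambda>i. a i / r) x\<bar>) = (\<lambda>x. (1 / r) * \<bar>linear_form n a x\<bar>)"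
    using r(1) by (auto simp: abs_mult)
  finally have "1 / (32 * exp (9 / 2)) \<le> (1 / r) * cube_expectation n (\<lambda>x. \<bar>linear_form n a x\<bar>)"
    by (simp only: cube_expectation_cmult)
  then show ?thesis
    unfolding r_def[symmetric] using r(1) by (simp add: field_simps)
qed

text \<open>
  Averaging over \<open>x\<close> and \<open>-x\<close> turns \<open>2 E[f X]\<close> into \<open>E[\<bar>X\<bar> D]\<close>, where \<open>D\<close> indicates that exactly
  one of the two points lies in the halfspace. This happens precisely when \<open>\<bar>X\<bar>\<close> is beyond \<open>\<bar>t\<bar>\<close>,
  so \<open>D\<close> is a nondecreasing function of \<open>\<bar>X\<bar>\<close> and Chebyshev's correlation inequality applies. The
  hypothesis \<open>\<mu> \<le> 1 / 2\<close> gives \<open>E D \<ge> 2 \<mu>\<close> for negative \<open>t\<close> as well, where \<open>E D = 2 - 2 \<mu>\<close>.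
\<close>

lemma expectation_linear_form_on_halfspace_ge:
  assumes "cube_expectation n (halfspace n a t) \<le> 1 / 2"
  shows "cube_expectation n (halfspace n a t) * cube_expectation n (\<lambda>x. \<bar>linear_form n a x\<bar>)
           \<le> cube_expectation n (\<lambda>x. halfspace n a t x * linear_form n a x)"
proof -
  define X where "X = linear_form n a"
  define \<mu> where "\<mu> = cube_expectation n (halfspace n a t)"
  define D where "D = (\<lambda>x. \<bar>of_bool (X x > t) - of_bool (- X x > t)\<bar> :: real)"
  define p where "p = cube_expectation n D"
  have mu: "\<mu> = cube_expectation n (\<lambda>x. of_bool (X x > t))"
    by (simp add: \<mu>_def X_def halfspace_eq[abs_def])
  have mu': "\<mu> = cube_expectation n (\<lambda>x. of_bool (- X x > t))"
    using mu cube_expectation_reflect[of n "\<lambda>x. of_bool (X x > t)"]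
    by (simp only: X_def linear_form_reflect)
  have p_ge: "2 * \<mu> \<le> p"
  proof (cases "0 \<le> t")
    case True
    have "p = cube_expectation n (\<lambda>x. of_bool (X x > t) + of_bool (- X x > t))"
      unfolding p_def D_def using True by (intro cube_expectation_cong) auto
    then show ?thesis unfolding cube_expectation_add using mu mu' by simp
  next
    case False
    have "p = cube_expectation n (\<lambda>x. 2 - (of_bool (X x > t) + of_bool (- X x > t)))"
      unfolding p_def D_def using False by (intro cube_expectation_cong) auto
    then have "p = 2 - (\<mu> + \<mu>)"
      unfolding cube_expectation_diff cube_expectation_add cube_expectation_const
      using mu mu' by simp
    then show ?thesis using assms by (simp add: \<mu>_def)
  qed
  have p01: "0 \<le> p" "p \<le> 1"
    using cube_expectation_mono[of n D "\<lambda>_. 1"]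
    by (auto simp: p_def cube_expectation_const D_def intro!: cube_expectation_nonneg)
  \<comment> \<open>Chebyshev's correlation inequality, with \<open>\<bar>t\<bar>\<close> as the level at which \<open>D\<close> jumps.\<close>
  have "cube_expectation n (\<lambda>x. p * \<bar>X x\<bar> + \<bar>t\<bar> * (D x - p)) \<le> cube_expectation n (\<lambda>x. \<bar>X x\<bar> * D x)"
  proof (rule cube_expectation_mono)
    fix x
    have "(D x = 1 \<and> \<bar>t\<bar> \<le> \<bar>X x\<bar>) \<or> (D x = 0 \<and> \<bar>X x\<bar> \<le> \<bar>t\<bar>)"
      by (auto simp: D_def)
    then have "0 \<le> (\<bar>X x\<bar> - \<bar>t\<bar>) * (D x - p)"
      using p01 by (auto intro: mult_nonneg_nonneg mult_nonpos_nonpos)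
    then show "p * \<bar>X x\<bar> + \<bar>t\<bar> * (D x - p) \<le> \<bar>X x\<bar> * D x"
      by (simp add: algebra_simps)
  qed
  then have corr: "p * cube_expectation n (\<lambda>x. \<bar>X x\<bar>) \<le> cube_expectation n (\<lambda>x. \<bar>X x\<bar> * D x)"
    by (simp add: cube_expectation_add cube_expectation_cmult cube_expectation_diff
        cube_expectation_const flip: p_def)
  define F where "F = cube_expectation n (\<lambda>x. of_bool (X x > t) * X x)"
  have "F = cube_expectation n (\<lambda>x. of_bool (- X x > t) * (- X x))"
    using F_def cube_expectation_reflect[of n "\<lambda>x. of_bool (X x > t) * X x"]
    by (simp only: X_def linear_form_reflect)
  then have "2 * F = cube_expectation n (\<lambda>x. of_bool (X x > t) * X x + of_bool (- X x > t) * (- X x))"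
    unfolding cube_expectation_add by (simp add: F_def)
  also have "\<dots> = cube_expectation n (\<lambda>x. \<bar>X x\<bar> * D x)"
    by (rule cube_expectation_cong) (auto simp: D_def)
  finally have "2 * F = cube_expectation n (\<lambda>x. \<bar>X x\<bar> * D x)" .
  moreover have "2 * \<mu> * cube_expectation n (\<lambda>x. \<bar>X x\<bar>) \<le> p * cube_expectation n (\<lambda>x. \<bar>X x\<bar>)"
    by (intro mult_right_mono p_ge cube_expectation_nonneg) auto
  ultimately have "\<mu> * cube_expectation n (\<lambda>x. \<bar>X x\<bar>) \<le> F"
    using corr by linarith
  then show ?thesis
    by (simp add: \<mu>_def F_def X_def halfspace_eq[abs_def])
qed

text \<open>
  This lacks the logarithmic factor; it serves the range in which \<open>log (1 / \<mu>)\<close> is bounded.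
\<close>

lemma level1_lower_any_measure:
  assumes pos: "0 < cube_expectation n (halfspace n a t)"
    and half: "cube_expectation n (halfspace n a t) \<le> 1 / 2"
  shows "(cube_expectation n (halfspace n a t))\<^sup>2 / (32 * exp (9 / 2))\<^sup>2
           \<le> level1_weight n (halfspace n a t)"
proof -
  define f where "f = halfspace n a t"
  define \<mu> where "\<mu> = cube_expectation n f"
  define A where "A = (\<Sum>i=1..n. (a i)\<^sup>2)"
  define K where "K = 32 * exp (9 / 2 :: real)"
  have K: "0 < K" by (simp add: K_def)
  have mu: "0 < \<mu>" using pos by (simp add: \<mu>_def f_def)
  have A0: "0 \<le> A" unfolding A_def by (intro sum_nonneg) auto
  have "A \<noteq> 0"
  proof
    assume "A = 0"
    then have "\<forall>i\<in>{1..n}. a i = 0"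
      unfolding A_def by (subst (asm) sum_nonneg_eq_0_iff) auto
    then have "f = (\<lambda>x. of_bool (0 > t))"
      by (simp add: f_def halfspace_eq[abs_def] linear_form_def)
    then have "\<mu> = of_bool (0 > t)" by (simp add: \<mu>_def cube_expectation_const)
    then show False using mu half by (auto simp: \<mu>_def f_def split: if_splits)
  qed
  with A0 have A: "0 < A" by simp
  have "\<mu> * (sqrt A / K) \<le> \<mu> * cube_expectation n (\<lambda>x. \<bar>linear_form n a x\<bar>)"
    using Khinchine[where a = a and n = n] mu by (intro mult_left_mono) (auto simp: A_def K_def)
  also have "\<dots> \<le> cube_expectation n (\<lambda>x. f x * linear_form n a x)"
    using expectation_linear_form_on_halfspace_ge[OF half] by (simp add: \<mu>_def f_def)
  finally have "(\<mu> * (sqrt A / K))\<^sup>2 \<le> (cube_expectation n (\<lambda>x. f x * linear_form n a x))\<^sup>2"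
    using mu A K by (intro power_mono) auto
  also have "\<dots> \<le> A * level1_weight n f"
    unfolding A_def by (rule expectation_linear_form_square_le)
  finally have "A * (\<mu>\<^sup>2 / K\<^sup>2) \<le> A * level1_weight n f"
    using A by (simp add: power_mult_distrib power_divide algebra_simps)
  then have "\<mu>\<^sup>2 / K\<^sup>2 \<le> level1_weight n f"
    using A by (subst (asm) mult_le_cancel_left_pos) auto
  then show ?thesis by (simp add: \<mu>_def f_def K_def)
qed

section \<open>Both bounds\<close>

theorem theorem1p1:
  shows "\<exists>c::real. c > 0 \<and>
    (\<forall>n::nat. n \<ge> 1 \<longrightarrow> (\<forall>(a::nat \<Rightarrow> real) (t::real).
      cube_expectation n (halfspace n a t) \<le> 1 / 2 \<longrightarrow>
        c * sq_log_inv (cube_expectation n (halfspace n a t)) \<le> level1_weight n (halfspace n a t) \<and>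
        level1_weight n (halfspace n a t) \<le> 2 * sq_log_inv (cube_expectation n (halfspace n a t))))"
proof -
  define K where "K = 32 * exp (9 / 2 :: real)"
  define c where "c = min (1 / 256) (1 / (32 * K\<^sup>2))"
  have "0 < K" by (simp add: K_def)
  then have c: "0 < c" by (simp add: c_def)
  have lower: "c * sq_log_inv (cube_expectation n (halfspace n a t)) \<le> level1_weight n (halfspace n a t)"
    if half: "cube_expectation n (halfspace n a t) \<le> 1 / 2" for n a t
  proof (cases "cube_expectation n (halfspace n a t) = 0")
    case True
    then show ?thesis by (simp add: sq_log_inv_def level1_weight_def sum_nonneg)
  next
    case False
    define \<mu> where "\<mu> = cube_expectation n (halfspace n a t)"
    define k where "k = ln (1 / \<mu>)"
    have "0 \<le> \<mu>" unfolding \<mu>_def by (intro cube_expectation_nonneg) (simp add: halfspace_eq)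
    with False have mu: "0 < \<mu>" by (simp add: \<mu>_def)
    have k0: "0 \<le> k" using mu half by (simp add: k_def \<mu>_def)
    have "c * (\<mu>\<^sup>2 * k) \<le> level1_weight n (halfspace n a t)"
    proof (cases "32 \<le> k")
      case True
      have "c * (\<mu>\<^sup>2 * k) \<le> (1 / 256) * (\<mu>\<^sup>2 * k)"
        using k0 by (intro mult_right_mono) (auto simp: c_def)
      also have "\<dots> \<le> level1_weight n (halfspace n a t)"
        using level1_lower_small_measure[of n a t k] mu True by (simp add: k_def \<mu>_def)
      finally show ?thesis .
    next
      case False
      have "c * (\<mu>\<^sup>2 * k) \<le> (1 / (32 * K\<^sup>2)) * (\<mu>\<^sup>2 * 32)"
        using k0 c False by (intro mult_mono) (auto simp: c_def)
      also have "\<dots> \<le> level1_weight n (halfspace n a t)"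
        using level1_lower_any_measure[of n a t] mu half by (simp add: K_def \<mu>_def)
      finally show ?thesis .
    qed
    then show ?thesis using mu by (simp add: sq_log_inv_def k_def \<mu>_def)
  qed
  have upper: "level1_weight n (halfspace n a t) \<le> 2 * sq_log_inv (cube_expectation n (halfspace n a t))"
    for n a t
    by (rule level1_inequality) (simp add: halfspace_eq)
  show ?thesis
    using c lower upper by blast
qed

end
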